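(* Let $A$ be a divisor of $F$ with $\deg(A)\geq 2g-1$, and let $U\subseteq L(A)$ be a $K$-subspace, so that $U^2\subseteq L(2A)$. Let $\varphi\in\Phi_{2A}(U^2)$ be a linear form and let $X$ be a formal expression of weight $W(X)=w$ such that $\varphi=X_{2A}$. Define $$T:=U\cap\bigcap_{\chi\in\langle D_X\rangle_A}\ker(\chi).$$ Then $$\operatorname{codim}_U(T)\leq\frac{w}{2}.$$
   Context: $K$ is an algebraically closed field and $F/K$ is a function field of transcendence degree $1$ and genus $g$. For a divisor $A$, $v_P(A)$ is the coefficient of the place $P$ in $A$, $L(A)=\{f\in F^\times:(f)+A\geq 0\}\cup\{0\}$, and $L(A)^\ast$ is its $K$-dual. $U^2$ is the $K$-span of all products of two elements of $U$. Fix a local parameter $t_P$ at every place $P$ of $F$. For an integer $m\geq 0$, $\operatorname{ev}_A(P,m)\in L(A)^\ast$ sends $f=\sum_{n\geq -v_P(A)}a_nt_P^n$ (local expansion at $P$) to $a_{-v_P(A)+m}$. A formal expression is a finite $K$-linear combination $X=\sum_{P,m}\lambda_{P,m}\operatorname{ev}(P,m)$ in the $K$-vector space with basis the formal symbols $\operatorname{ev}(P,m)$ ($P$ a place, $m\geq 0$). Its projection to $L(A)^\ast$ is $X_A:=\sum_{P,m}\lambda_{P,m}\operatorname{ev}_A(P,m)$. Put $r_P(X)=\max\{m:\lambda_{P,m}\neq 0\}$, or $-1$ if all $\lambda_{P,m}=0$; the divisor of $X$ is $D_X=\sum_P(r_P(X)+1)P$ and the weight of $X$ is $W(X)=\deg(D_X)$.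 For a divisor $E=\sum_P r_PP\geq 0$, $\langle E\rangle_A\subseteq L(A)^\ast$ is the $K$-span of all $\operatorname{ev}_A(P,m)$ with $0\leq m\leq r_P-1$. For a subspace $V\subseteq L(A)$, $\Phi_A(V)=\{\psi\in L(A)^\ast:\psi(V)=0\}$. *)

theory Defs
  imports
    "HOL-Computational_Algebra.Formal_Laurent_Series"
    "HOL-Library.Poly_Mapping"
    "HOL-Library.Function_Algebras"
    "HOL-Library.Extended_Real"
begin

text \<open>
  An extension \<open>F/K\<close> is given by two field types and an embedding \<open>emb\<close> of \<open>K\<close> into \<open>F\<close>.
  Subspaces, spans and dimensions over \<open>K\<close> are the library notions \<^const>\<open>module.subspace\<close>,
  \<^const>\<open>module.span\<close> and \<^const>\<open>vector_space.dim\<close>, taken for the following scalar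
  multiplications on \<open>F\<close> and on \<open>K\<close>-valued functions on \<open>F\<close>.
\<close>

definition scaleF :: "('k::field \<Rightarrow> 'f::field) \<Rightarrow> 'k \<Rightarrow> 'f \<Rightarrow> 'f" where
  "scaleF emb c f = emb c * f"

definition scale_form :: "'k::field \<Rightarrow> ('f \<Rightarrow> 'k) \<Rightarrow> 'f \<Rightarrow> 'k" where
  "scale_form c \<psi> = (\<lambda>f. c * \<psi> f)"

lemma vector_space_scale_form: "vector_space (scale_form :: 'k::field \<Rightarrow> ('f \<Rightarrow> 'k) \<Rightarrow> 'f \<Rightarrow> 'k)"
  by unfold_locales (auto simp: scale_form_def fun_eq_iff algebra_simps)


subsection \<open>Function fields, places and valuations\<close>

definition transcendental :: "('k::field \<Rightarrow> 'f::field) \<Rightarrow> 'f \<Rightarrow> bool" where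
  "transcendental emb x \<longleftrightarrow> (\<forall>p. p \<noteq> 0 \<longrightarrow> poly (map_poly emb p) x \<noteq> 0)"

definition simple_extension :: "('k::field \<Rightarrow> 'f::field) \<Rightarrow> 'f \<Rightarrow> 'f set" where
  "simple_extension emb x =
     {poly (map_poly emb p) x / poly (map_poly emb q) x | p q. poly (map_poly emb q) x \<noteq> 0}"

text \<open>
  A function field of transcendence degree one is a finite extension of a rational function
  field \<open>K(x)\<close>.
\<close>

locale function_field =
  fixes emb :: "'k::alg_closed_field \<Rightarrow> 'f::field"
  assumes emb_one: "emb 1 = 1"
    and emb_add: "emb (a + b) = emb a + emb b"
    and emb_mult: "emb (a * b) = emb a * emb b"
    and finite_over_rational:
      "\<exists>x. transcendental emb x \<and>
         (\<exists>B. finite B \<and>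
            (\<forall>y. \<exists>c. (\<forall>b\<in>B. c b \<in> simple_extension emb x) \<and> y = (\<Sum>b\<in>B. c b * b)))"

lemma (in function_field) vector_space_scaleF: "vector_space (scaleF emb)"
  by unfold_locales (auto simp: scaleF_def emb_one emb_add emb_mult algebra_simps)

definition valuation_ring_over :: "('k::field \<Rightarrow> 'f::field) \<Rightarrow> 'f set \<Rightarrow> bool" where
  "valuation_ring_over emb R \<longleftrightarrow>
     (\<forall>a\<in>R. \<forall>b\<in>R. a - b \<in> R \<and> a * b \<in> R) \<and>
     range emb \<subset> R \<and> R \<subset> UNIV \<and>
     (\<forall>z. z \<noteq> 0 \<longrightarrow> z \<in> R \<or> inverse z \<in> R)"

text \<open>A place is the maximal ideal, i.e. the set of non-units, of a valuation ring of \<open>F/K\<close>.\<close>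

definition places :: "('k::field \<Rightarrow> 'f::field) \<Rightarrow> 'f set set" where
  "places emb =
     {P. \<exists>R. valuation_ring_over emb R \<and> P = {z \<in> R. z = 0 \<or> inverse z \<notin> R}}"

text \<open>The valuation ring is recovered from its place.\<close>

definition ring_of_place :: "'f::field set \<Rightarrow> 'f set" where
  "ring_of_place P = {z. z = 0 \<or> inverse z \<notin> P}"

definition local_parameter :: "'f::field set \<Rightarrow> 'f \<Rightarrow> bool" where
  "local_parameter P t \<longleftrightarrow> P = {t * z | z. z \<in> ring_of_place P}"

text \<open>
  Only meaningful for \<open>f \<noteq> 0\<close>: the value \<open>\<infinity>\<close> at \<open>0\<close> is not represented, so uses below treat
  \<open>f = 0\<close> separately.
\<close>

definition val :: "'f::field set \<Rightarrow> 'f \<Rightarrow> int" where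
  "val P f = (THE n. \<exists>t u. local_parameter P t \<and> u \<in> ring_of_place P - P \<and> f = t powi n * u)"


subsection \<open>Divisors, Riemann-Roch spaces and the genus\<close>

definition divisors :: "('k::field \<Rightarrow> 'f::field) \<Rightarrow> ('f set \<Rightarrow>\<^sub>0 int) set" where
  "divisors emb = {A. Poly_Mapping.keys A \<subseteq> places emb}"

text \<open>Every place has degree one, since \<open>K\<close> is algebraically closed.\<close>

definition deg :: "('f set \<Rightarrow>\<^sub>0 int) \<Rightarrow> int" where
  "deg A = (\<Sum>P\<in>Poly_Mapping.keys A. Poly_Mapping.lookup A P)"

definition RR_space :: "('k::field \<Rightarrow> 'f::field) \<Rightarrow> ('f set \<Rightarrow>\<^sub>0 int) \<Rightarrow> 'f set" where
  "RR_space emb A =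
     {f. f \<noteq> 0 \<and> (\<forall>P\<in>places emb. val P f + Poly_Mapping.lookup A P \<ge> 0)} \<union> {0}"

text \<open>
  The set below is bounded (Riemann's theorem), so that the supremum is a maximum.
\<close>

definition genus :: "('k::field \<Rightarrow> 'f::field) \<Rightarrow> int" where
  "genus emb =
     Sup {deg A - int (vector_space.dim (scaleF emb) (RR_space emb A)) + 1 | A. A \<in> divisors emb}"


subsection \<open>Linear forms\<close>

text \<open>
  Linear forms on a subspace \<open>V\<close> of \<open>F\<close> are encoded as functions on all of \<open>F\<close> vanishing outside
  \<open>V\<close>, so that equality and the pointwise operations are those of the dual space of \<open>V\<close>.
\<close>

definition dual :: "('k::field \<Rightarrow> 'f::field) \<Rightarrow> 'f set \<Rightarrow> ('f \<Rightarrow> 'k) set" where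
  "dual emb V =
     {\<psi>. (\<forall>f. f \<notin> V \<longrightarrow> \<psi> f = 0) \<and>
         (\<forall>f\<in>V. \<forall>g\<in>V. \<psi> (f + g) = \<psi> f + \<psi> g) \<and>
         (\<forall>c. \<forall>f\<in>V. \<psi> (scaleF emb c f) = c * \<psi> f)}"

definition annihilator ::
    "('k::field \<Rightarrow> 'f::field) \<Rightarrow> ('f set \<Rightarrow>\<^sub>0 int) \<Rightarrow> 'f set \<Rightarrow> ('f \<Rightarrow> 'k) set" where
  "annihilator emb A V = {\<psi> \<in> dual emb (RR_space emb A). \<forall>f\<in>V. \<psi> f = 0}"

definition square_space :: "('k::field \<Rightarrow> 'f::field) \<Rightarrow> 'f set \<Rightarrow> 'f set" where
  "square_space emb U = module.span (scaleF emb) {u * v | u v. u \<in> U \<and> v \<in> U}"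

text \<open>
  The dimension of \<open>U/T\<close>, for subspaces \<open>T \<subseteq> U\<close> of \<open>F\<close>, as the supremum of the sizes of finite
  sets that are linearly independent modulo \<open>T\<close>; it is \<open>\<infinity>\<close> if \<open>U/T\<close> is infinite-dimensional.
\<close>

definition codim :: "('k::field \<Rightarrow> 'f::field) \<Rightarrow> 'f set \<Rightarrow> 'f set \<Rightarrow> enat" where
  "codim emb U T =
     (SUP B\<in>{B. finite B \<and> B \<subseteq> U \<and>
               (\<forall>c. (\<Sum>b\<in>B. scaleF emb (c b) b) \<in> T \<longrightarrow> (\<forall>b\<in>B. c b = 0))}. enat (card B))"


subsection \<open>Local expansions and evaluation forms\<close>

text \<open>
  The Laurent series \<open>s\<close> in \<open>t\<close> converges to \<open>f\<close> at \<open>P\<close>: the remainder of the partial sum over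
  exponents below \<open>N\<close> has valuation at least \<open>N\<close>.
\<close>

definition is_local_expansion ::
    "('k::field \<Rightarrow> 'f::field) \<Rightarrow> 'f set \<Rightarrow> 'f \<Rightarrow> 'f \<Rightarrow> 'k fls \<Rightarrow> bool" where
  "is_local_expansion emb P t f s \<longleftrightarrow>
     (\<forall>N. let r = f - (\<Sum>n\<in>{fls_subdegree s..<N}. scaleF emb (fls_nth s n) (t powi n))
          in r = 0 \<or> val P r \<ge> N)"

definition local_expansion ::
    "('k::field \<Rightarrow> 'f::field) \<Rightarrow> 'f set \<Rightarrow> 'f \<Rightarrow> 'f \<Rightarrow> 'k fls" where
  "local_expansion emb P t f = (THE s. is_local_expansion emb P t f s)"

text \<open>In the following, \<open>t\<close> is a choice of a local parameter at every place.\<close>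

definition ev ::
    "('k::field \<Rightarrow> 'f::field) \<Rightarrow> ('f set \<Rightarrow> 'f) \<Rightarrow> ('f set \<Rightarrow>\<^sub>0 int) \<Rightarrow> 'f set \<Rightarrow> nat \<Rightarrow> 'f \<Rightarrow> 'k" where
  "ev emb t A P m = (\<lambda>f. if f \<in> RR_space emb A
      then fls_nth (local_expansion emb P (t P) f) (- Poly_Mapping.lookup A P + int m) else 0)"

definition formal_expressions ::
    "('k::field \<Rightarrow> 'f::field) \<Rightarrow> ('f set \<times> nat \<Rightarrow>\<^sub>0 'k) set" where
  "formal_expressions emb = {X. Poly_Mapping.keys X \<subseteq> places emb \<times> UNIV}"

definition projection ::
    "('k::field \<Rightarrow> 'f::field) \<Rightarrow> ('f set \<Rightarrow> 'f) \<Rightarrow> ('f set \<Rightarrow>\<^sub>0 int) \<Rightarrow>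
       ('f set \<times> nat \<Rightarrow>\<^sub>0 'k) \<Rightarrow> 'f \<Rightarrow> 'k" where
  "projection emb t A X =
     (\<Sum>(P, m)\<in>Poly_Mapping.keys X. scale_form (Poly_Mapping.lookup X (P, m)) (ev emb t A P m))"

definition top_index :: "('f set \<times> nat \<Rightarrow>\<^sub>0 'k::zero) \<Rightarrow> 'f set \<Rightarrow> int" where
  "top_index X P =
     (if \<forall>m. Poly_Mapping.lookup X (P, m) = 0 then -1
      else int (Max {m. Poly_Mapping.lookup X (P, m) \<noteq> 0}))"

definition expr_divisor :: "('f set \<times> nat \<Rightarrow>\<^sub>0 'k::zero) \<Rightarrow> 'f set \<Rightarrow>\<^sub>0 int" where
  "expr_divisor X =
     (\<Sum>P\<in>fst ` Poly_Mapping.keys X. Poly_Mapping.single P (top_index X P + 1))"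

definition weight :: "('f set \<times> nat \<Rightarrow>\<^sub>0 'k::zero) \<Rightarrow> int" where
  "weight X = deg (expr_divisor X)"

definition ev_span ::
    "('k::field \<Rightarrow> 'f::field) \<Rightarrow> ('f set \<Rightarrow> 'f) \<Rightarrow> ('f set \<Rightarrow>\<^sub>0 int) \<Rightarrow> ('f set \<Rightarrow>\<^sub>0 int) \<Rightarrow>
       ('f \<Rightarrow> 'k) set" where
  "ev_span emb t E A =
     module.span scale_form
       {ev emb t A P m | P m. P \<in> places emb \<and> int m \<le> Poly_Mapping.lookup E P - 1}"

end

theory Submission
  imports Defs
begin

text \<open>
  A linear form \<open>\<phi>\<close> that vanishes on \<open>U\<^sup>2\<close> makes the bilinear form \<open>(f, g) \<mapsto> \<phi>(f g)\<close> vanish on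
  \<open>U \<times> U\<close>. The expression \<open>X\<close> shows how degenerate this form can be on \<open>L(A)\<close>. Multiplying local
  expansions (\<open>ev_mult\<close>) gives
  \<open>ev(P, m)(f g) = \<Sum>i\<le>m. ev(P, i)(f) * ev(P, m - i)(g)\<close>,
  with the coefficients of \<open>f g\<close> counted in \<open>L(2A)\<close> and those of \<open>f\<close>, \<open>g\<close> in \<open>L(A)\<close>. Hence \<open>\<phi>(f g)\<close>
  depends only on the coordinates \<open>ev(P, i)\<close> with \<open>i \<le> r\<^sub>P(X)\<close> of \<open>f\<close> and \<open>g\<close>. There are \<open>w\<close> of them,
  and the form that \<open>X\<close> defines on \<open>K\<^sup>w\<close> is nondegenerate, because at each place its matrix is
  triangular with respect to the antidiagonal (\<open>expr_form_nondegenerate\<close>). The image of \<open>U\<close> in \<open>K\<^sup>w\<close>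
  is isotropic, so its dimension is at most \<open>w/2\<close> (\<open>isotropic_dim_le_half\<close>). The kernel of
  \<open>U \<rightarrow> K\<^sup>w\<close> is \<open>T\<close>.
  
  The rest is the existence of local expansions. Given a generator \<open>t\<close> of the place, it requires
  that no nonzero function is divisible by all powers of \<open>t\<close> and that the residue field is \<open>K\<close>. Both
  follow from the algebraic dependence of any two functions (\<open>algebraically_dependent\<close>), which is
  proved by comparing the number of monomials in them with the growth of spaces of bounded degree.
  The coefficients of an expansion are then residues, extracted one after the other.
\<close>

section \<open>Isotropic subspaces of nondegenerate forms\<close>

lemma (in vector_space) family_independent:
  assumes "finite J" "\<And>c. (\<Sum>j\<in>J. scale (c j) (v j)) = 0 \<Longrightarrow> \<forall>j\<in>J. c j = 0"
  shows "inj_on v J \<and> independent (v ` J)"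
proof
  show inj: "inj_on v J"
  proof (rule inj_onI, rule ccontr)
    fix i j assume ij: "i \<in> J" "j \<in> J" "v i = v j" "i \<noteq> j"
    define c where "c k = (if k = i then 1 else if k = j then - 1 else 0 :: 'a)" for k
    have "(\<Sum>k\<in>J. scale (c k) (v k)) = (\<Sum>k\<in>{i, j}. scale (c k) (v k))"
      using ij \<open>finite J\<close> by (intro sum.mono_neutral_right) (auto simp: c_def)
    also have "\<dots> = 0"
      using ij by (simp add: c_def)
    finally have "c i = 0"
      using assms(2) ij(1) by blast
    then show False
      by (simp add: c_def)
  qed
  show "independent (v ` J)"
  proof (rule independent_if_scalars_zero)
    fix u x assume u: "(\<Sum>x\<in>v ` J. scale (u x) x) = 0" "x \<in> v ` J"
    then have "(\<Sum>j\<in>J. scale (u (v j)) (v j)) = 0"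
      by (simp add: sum.reindex[OF inj])
    from assms(2)[OF this] u(2) show "u x = 0"
      by auto
  qed (use \<open>finite J\<close> in simp)
qed

lemma (in vector_space) exists_nontrivial_relation:
  assumes "finite J" "finite S" "card S < card J" "\<And>j. j \<in> J \<Longrightarrow> v j \<in> span S"
  shows "\<exists>c. (\<exists>j\<in>J. c j \<noteq> 0) \<and> (\<Sum>j\<in>J. scale (c j) (v j)) = 0"
proof (rule ccontr)
  assume "\<not> ?thesis"
  then have *: "inj_on v J" "independent (v ` J)"
    using family_independent[OF \<open>finite J\<close>, of v] by blast+
  have "v ` J \<subseteq> span S"
    using assms(4) by auto
  with *(2) have "card (v ` J) \<le> card S"
    using independent_span_bound[OF \<open>finite S\<close>] by blast
  with *(1) \<open>card S < card J\<close> show False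
    by (simp add: card_image)
qed

interpretation form: vector_space "scale_form :: 'k::field \<Rightarrow> ('i \<Rightarrow> 'k) \<Rightarrow> 'i \<Rightarrow> 'k"
  by (rule vector_space_scale_form)

lemma sum_fun_apply: "(\<Sum>i\<in>I. g i) x = (\<Sum>i\<in>I. g i x)"
  by (induction I rule: infinite_finite_induct) (auto simp: zero_fun_def)

definition unit_vector :: "'i \<Rightarrow> 'i \<Rightarrow> 'k::field" where
  "unit_vector i = (\<lambda>j. if j = i then 1 else 0)"

lemma inj_unit_vector: "inj (unit_vector :: 'i \<Rightarrow> 'i \<Rightarrow> 'k::field)"
  by (rule injI) (metis unit_vector_def zero_neq_one)

lemma in_span_unit_vectors_iff:
  assumes "finite I"
  shows "v \<in> form.span (unit_vector ` I) \<longleftrightarrow> (\<forall>i. i \<notin> I \<longrightarrow> v i = 0)"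
proof
  assume "v \<in> form.span (unit_vector ` I)"
  then show "\<forall>i. i \<notin> I \<longrightarrow> v i = 0"
    by (induction rule: form.span_induct_alt) (auto simp: scale_form_def unit_vector_def split: if_splits)
next
  assume v: "\<forall>i. i \<notin> I \<longrightarrow> v i = 0"
  have "v = (\<Sum>i\<in>I. scale_form (v i) (unit_vector i))"
  proof
    fix j
    show "v j = (\<Sum>i\<in>I. scale_form (v i) (unit_vector i)) j"
      using v \<open>finite I\<close>
      by (simp add: sum_fun_apply scale_form_def unit_vector_def if_distrib cong: if_cong)
  qed
  also have "\<dots> \<in> form.span (unit_vector ` I)"
    by (intro form.span_sum form.span_scale form.span_base) auto
  finally show "v \<in> form.span (unit_vector ` I)" .
qed

context vector_space
begin

text \<open>
  An isotropic subspace \<open>W\<close> lies in its own orthogonal complement, which has the complementary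
  dimension because \<open>\<beta>\<close> is nondegenerate. Counting equations replaces the complement here: after
  extending \<open>B\<close> to a basis \<open>C\<close>, a combination \<open>y\<close> of \<open>B\<close> is orthogonal to \<open>B\<close> anyway, so
  orthogonality to everything costs only \<open>card C - card B\<close> equations in \<open>card B\<close> unknowns. If \<open>B\<close>
  had more than half the dimension, some \<open>y \<noteq> 0\<close> would solve them.
\<close>
lemma isotropic_dim_le_half:
  fixes \<beta> :: "'b \<Rightarrow> 'b \<Rightarrow> 'a"
  assumes "finite S"
    and add_left: "\<And>x y z. \<beta> (x + y) z = \<beta> x z + \<beta> y z"
    and scale_left: "\<And>c x z. \<beta> (scale c x) z = c * \<beta> x z"
    and add_right: "\<And>x y z. \<beta> x (y + z) = \<beta> x y + \<beta> x z"
    and scale_right: "\<And>c x y. \<beta> x (scale c y) = c * \<beta> x y"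
    and nondegenerate: "\<And>y. y \<in> span S \<Longrightarrow> (\<And>x. x \<in> S \<Longrightarrow> \<beta> x y = 0) \<Longrightarrow> y = 0"
    and B: "independent B" "B \<subseteq> span S"
    and isotropic: "\<And>x y. x \<in> B \<Longrightarrow> y \<in> B \<Longrightarrow> \<beta> x y = 0"
  shows "2 * card B \<le> card S"
proof (rule ccontr)
  assume "\<not> 2 * card B \<le> card S"
  obtain C where C: "B \<subseteq> C" "C \<subseteq> span S" "independent C" "span S \<subseteq> span C"
    using maximal_independent_subset_extend[OF B(2,1)] by blast
  from independent_span_bound[OF \<open>finite S\<close> C(3,2)] have "finite C" "card C \<le> card S"
    by auto
  then have "finite B"
    using C(1) finite_subset by blast
  have "card (C - B) < card B"
    using \<open>\<not> 2 * card B \<le> card S\<close> \<open>card C \<le> card S\<close> C(1) \<open>finite B\<close> by (simp add: card_Diff_subset)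
  moreover have "card (unit_vector ` (C - B) :: ('b \<Rightarrow> 'a) set) \<le> card (C - B)"
    using \<open>finite C\<close> by (intro card_image_le) simp
  \<comment> \<open>The vector attached to \<open>b\<close> lists the values of the equations indexed by \<open>C - B\<close> at \<open>b\<close>.\<close>
  ultimately obtain u where u: "\<exists>b\<in>B. u b \<noteq> 0"
    "(\<Sum>b\<in>B. scale_form (u b) (\<lambda>c. if c \<in> C - B then \<beta> c b else 0)) = 0"
    using form.exists_nontrivial_relation[of B "unit_vector ` (C - B)"
        "\<lambda>b c. if c \<in> C - B then \<beta> c b else 0"] \<open>finite B\<close> \<open>finite C\<close>
    by (force simp: in_span_unit_vectors_iff)
  define y where "y = (\<Sum>b\<in>B. scale (u b) b)"
  have zero_left: "\<beta> 0 z = 0" and zero_right: "\<beta> z 0 = 0" for z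
    using scale_left[of 0 0 z] scale_right[of z 0 0] by simp_all
  have \<beta>y: "\<beta> x y = (\<Sum>b\<in>B. u b * \<beta> x b)" for x
    unfolding y_def
    by (induction B rule: infinite_finite_induct) (auto simp: zero_right add_right scale_right)
  have perp_basis: "\<beta> c y = 0" if "c \<in> C" for c
  proof (cases "c \<in> B")
    case True
    then show ?thesis
      by (simp add: \<beta>y isotropic)
  next
    case False
    then show ?thesis
      using fun_cong[OF u(2), of c] that by (simp add: \<beta>y sum_fun_apply scale_form_def)
  qed
  have perp_span: "\<beta> x y = 0" if "x \<in> span C" for x
    using that
    by (induction rule: span_induct_alt) (auto simp: zero_left add_left scale_left perp_basis)
  have "y = 0"
  proof (rule nondegenerate)
    show "y \<in> span S"
      unfolding y_def using B(2) by (intro span_sum span_scale) auto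
    show "\<beta> x y = 0" if "x \<in> S" for x
      using that C(4) by (intro perp_span) (auto intro: span_base)
  qed
  with B(1) \<open>finite B\<close> have "\<forall>b\<in>B. u b = 0"
    using independentD[of B B u] unfolding y_def by blast
  with u(1) show False
    by blast
qed

end

section \<open>Algebraic dependence in function fields\<close>

context function_field
begin

sublocale F: vector_space "scaleF emb"
  by (rule vector_space_scaleF)

lemma emb_0 [simp]: "emb 0 = 0"
  using emb_add[of 0 0] by (metis add.right_neutral add_left_cancel)

lemma emb_minus [simp]: "emb (- a) = - emb a"
  using emb_add[of a "- a"] by (simp add: eq_neg_iff_add_eq_0 add.commute)

lemma emb_diff: "emb (a - b) = emb a - emb b"
  using emb_add[of a "- b"] by simp

lemma emb_inverse: "a \<noteq> 0 \<Longrightarrow> emb a * emb (inverse a) = 1"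
  by (simp add: emb_one flip: emb_mult)

lemma emb_eq_0_iff [simp]: "emb a = 0 \<longleftrightarrow> a = 0"
  using emb_inverse[of a] by (metis emb_0 mult_zero_left zero_neq_one)

definition eval_at :: "'f \<Rightarrow> 'k poly \<Rightarrow> 'f" where
  "eval_at x p = poly (map_poly emb p) x"

lemma eval_at_0 [simp]: "eval_at x 0 = 0"
  by (simp add: eval_at_def)

lemma eval_at_pCons [simp]: "eval_at x (pCons a p) = emb a + x * eval_at x p"
  by (simp add: eval_at_def map_poly_pCons)

lemma eval_at_add: "eval_at x (p + q) = eval_at x p + eval_at x q"
  by (induction p q rule: poly_induct2) (auto simp: emb_add algebra_simps)

lemma eval_at_smult: "eval_at x (smult c p) = emb c * eval_at x p"
  by (induction p) (auto simp: emb_mult algebra_simps)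

lemma eval_at_mult: "eval_at x (p * q) = eval_at x p * eval_at x q"
  by (induction p) (auto simp: eval_at_add eval_at_smult algebra_simps)

lemma eval_at_monom: "eval_at x (monom c n) = emb c * x ^ n"
  by (simp add: eval_at_def map_poly_monom poly_monom)

lemma eval_at_sum: "eval_at x (sum f S) = (\<Sum>i\<in>S. eval_at x (f i))"
  by (induction S rule: infinite_finite_induct) (auto simp: eval_at_add)

lemma eval_at_altdef: "eval_at x p = (\<Sum>i\<le>degree p. emb (coeff p i) * x ^ i)"
  by (subst (1) poly_as_sum_of_monoms[symmetric]) (simp add: eval_at_sum eval_at_monom)


text \<open>
  The elements \<open>\<Sum>b p\<^sub>b b\<close> with polynomials \<open>p\<^sub>b\<close> in \<open>x\<close> of degree at most \<open>n\<close>. For finite \<open>B\<close> the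
  spanning set has at most \<open>(n + 1) * card B\<close> elements, so the dimension grows linearly in \<open>n\<close>; this
  linear growth is what transcendence degree one contributes to the proof.
\<close>
definition bounded_span :: "'f \<Rightarrow> 'f set \<Rightarrow> nat \<Rightarrow> 'f set" where
  "bounded_span x B n = F.span {x ^ k * b | k b. k \<le> n \<and> b \<in> B}"

lemma bounded_span_mono: "m \<le> n \<Longrightarrow> bounded_span x B m \<subseteq> bounded_span x B n"
  unfolding bounded_span_def by (intro F.span_mono) (auto intro: le_trans)

text \<open>
  An element that maps the generators \<open>B\<close> into bounded degree \<open>e\<close> raises the degree bound by at
  most \<open>e\<close>, so degree bounds for products of powers grow linearly in the exponents.
\<close>
lemma bounded_span_mult:
  assumes "\<And>b. b \<in> B \<Longrightarrow> a * b \<in> bounded_span x B e" "v \<in> bounded_span x B n"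
  shows "a * v \<in> bounded_span x B (n + e)"
  using assms(2) unfolding bounded_span_def
proof (induction rule: F.span_induct_alt)
  case base
  show ?case
    by (simp add: F.span_zero)
next
  case (step c u w)
  then obtain k b where kb: "u = x ^ k * b" "k \<le> n" "b \<in> B"
    by auto
  have shift: "x ^ k * w \<in> bounded_span x B (n + e)" if "w \<in> bounded_span x B e" for w
    using that unfolding bounded_span_def
  proof (induction rule: F.span_induct_alt)
    case base
    show ?case
      by (simp add: F.span_zero)
  next
    case (step c u w)
    then obtain l d where ld: "u = x ^ l * d" "l \<le> e" "d \<in> B"
      by auto
    then have "x ^ k * u = x ^ (k + l) * d" "k + l \<le> n + e"
      using kb by (auto simp: power_add)
    then have "x ^ k * u \<in> F.span {x ^ k * b | k b. k \<le> n + e \<and> b \<in> B}"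
      using ld by (intro F.span_base) blast
    from F.span_add[OF F.span_scale[OF this, of c] step(2)] show ?case
      unfolding scaleF_def distrib_left by (simp only: mult.left_commute)
  qed
  have "a * u \<in> F.span {x ^ k * b | k b. k \<le> n + e \<and> b \<in> B}"
    using shift[OF assms(1)[OF kb(3)]] by (simp add: kb bounded_span_def algebra_simps)
  from F.span_add[OF F.span_scale[OF this, of c] step(2)] show ?case
    unfolding scaleF_def distrib_left by (simp only: mult.left_commute)
qed

lemma eval_at_mult_bounded_span:
  assumes "v \<in> bounded_span x B n"
  shows "eval_at x p * v \<in> bounded_span x B (n + degree p)"
proof (rule bounded_span_mult[OF _ assms])
  fix b assume "b \<in> B"
  have "eval_at x p * b = (\<Sum>i\<le>degree p. scaleF emb (coeff p i) (x ^ i * b))"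
    by (simp add: eval_at_altdef sum_distrib_right scaleF_def mult.assoc)
  also have "\<dots> \<in> bounded_span x B (degree p)"
    unfolding bounded_span_def using \<open>b \<in> B\<close> by (intro F.span_sum F.span_scale F.span_base) auto
  finally show "eval_at x p * b \<in> bounded_span x B (degree p)" .
qed

lemma clear_denominators_sum:
  assumes "finite C" "C \<subseteq> B" "\<And>b. b \<in> C \<Longrightarrow> c b \<in> simple_extension emb x"
  shows "\<exists>q e. eval_at x q \<noteq> 0 \<and> eval_at x q * (\<Sum>b\<in>C. c b * b) \<in> bounded_span x B e"
  using assms
proof (induction rule: finite_induct)
  case empty
  show ?case
    by (intro exI[of _ "[:1:]"] exI[of _ 0]) (auto simp: emb_one bounded_span_def F.span_zero)
next
  case (insert b C)
  then obtain q e where q: "eval_at x q \<noteq> 0"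
      "eval_at x q * (\<Sum>b\<in>C. c b * b) \<in> bounded_span x B e"
    by auto
  from insert.prems(2)[of b] obtain p r where
    r: "eval_at x r \<noteq> 0" "c b = eval_at x p / eval_at x r"
    by (auto simp: simple_extension_def eval_at_def)
  have eq: "eval_at x (r * q) * (\<Sum>b\<in>insert b C. c b * b) =
      eval_at x r * (eval_at x q * (\<Sum>b\<in>C. c b * b)) + eval_at x (q * p) * b"
    using insert.hyps r by (simp add: eval_at_mult field_simps)
  have "b \<in> bounded_span x B 0"
    unfolding bounded_span_def using insert.prems by (intro F.span_base) auto
  from eval_at_mult_bounded_span[OF this, of "q * p"] eval_at_mult_bounded_span[OF q(2), of r]
  have "eval_at x (r * q) * (\<Sum>b\<in>insert b C. c b * b) \<in>
      bounded_span x B ((e + degree r) + degree (q * p))"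
    unfolding eq using bounded_span_mono[of "e + degree r" "(e + degree r) + degree (q * p)" x B]
       bounded_span_mono[of "degree (q * p)" "(e + degree r) + degree (q * p)" x B]
    by (auto simp: bounded_span_def intro!: F.span_add)
  moreover have "eval_at x (r * q) \<noteq> 0"
    using q r by (simp add: eval_at_mult)
  ultimately show ?case
    by blast
qed

text \<open>
  The product of the denominators of all coordinates with respect to \<open>B\<close> serves every element of
  \<open>S\<close>: multiplying by a further denominator only raises the degree bound.
\<close>
lemma clear_denominators:
  assumes "finite S" "finite B"
    and "\<And>y. \<exists>c. (\<forall>b\<in>B. c b \<in> simple_extension emb x) \<and> y = (\<Sum>b\<in>B. c b * b)"
  shows "\<exists>q e. eval_at x q \<noteq> 0 \<and> (\<forall>f\<in>S. eval_at x q * f \<in> bounded_span x B e)"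
  using assms(1)
proof (induction rule: finite_induct)
  case empty
  show ?case
    by (intro exI[of _ "[:1:]"]) (auto simp: emb_one)
next
  case (insert f S)
  then obtain q e where q: "eval_at x q \<noteq> 0" "\<forall>f\<in>S. eval_at x q * f \<in> bounded_span x B e"
    by auto
  obtain c where "\<forall>b\<in>B. c b \<in> simple_extension emb x" "f = (\<Sum>b\<in>B. c b * b)"
    using assms(3) by blast
  with clear_denominators_sum[OF assms(2), of B c x] obtain r d
    where r: "eval_at x r \<noteq> 0" "eval_at x r * f \<in> bounded_span x B d"
    by auto
  define m where "m = (e + degree r) + (d + degree q)"
  have "eval_at x (r * q) * g \<in> bounded_span x B m" if "g \<in> insert f S" for g
  proof (cases "g \<in> S")
    case True
    then show ?thesis
      using q(2) eval_at_mult_bounded_span[of "eval_at x q * g" x B e r]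
        bounded_span_mono[of "e + degree r" m x B]
      by (auto simp: eval_at_mult m_def algebra_simps)
  next
    case False
    then show ?thesis
      using that r(2) eval_at_mult_bounded_span[of "eval_at x r * f" x B d q]
        bounded_span_mono[of "d + degree q" m x B]
      by (auto simp: eval_at_mult m_def algebra_simps)
  qed
  moreover have "eval_at x (r * q) \<noteq> 0"
    using q r by (simp add: eval_at_mult)
  ultimately show ?case
    by blast
qed

text \<open>
  The \<open>(N + 1)\<^sup>2\<close> monomials \<open>y\<^sup>i z\<^sup>j\<close> with \<open>i, j \<le> N\<close>, multiplied by a power of a common
  denominator, lie in a space whose dimension is linear in \<open>N\<close>, so they are linearly dependent over
  \<open>K\<close> for large \<open>N\<close>. The relation is sorted by powers of \<open>z\<close>, the form in which powers of \<open>z\<close> can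
  be cancelled from it.
\<close>
lemma algebraically_dependent:
  "\<exists>p N. (\<exists>j\<le>N. p j \<noteq> 0) \<and> (\<Sum>j\<le>N. eval_at y (p j) * z ^ j) = 0"
proof -
  obtain x B where B: "finite B"
    "\<And>y. \<exists>c. (\<forall>b\<in>B. c b \<in> simple_extension emb x) \<and> y = (\<Sum>b\<in>B. c b * b)"
    using finite_over_rational by blast
  define S where "S = insert 1 ((\<lambda>b. y * b) ` B \<union> (\<lambda>b. z * b) ` B)"
  have "finite S"
    using B by (simp add: S_def)
  from clear_denominators[OF this B] obtain q e0
    where q: "eval_at x q \<noteq> 0" "\<And>f. f \<in> S \<Longrightarrow> eval_at x q * f \<in> bounded_span x B e0"
    by blast
  define D where "D = eval_at x q"
  define e where "e = e0 + degree q"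
  have "D \<noteq> 0"
    using q by (simp add: D_def)
  have D1: "D \<in> bounded_span x B e"
    using q(2)[of 1] bounded_span_mono[of e0 e x B] by (auto simp: S_def D_def e_def)
  have Db: "D * (a * b) \<in> bounded_span x B e" if "a \<in> {y, z}" "b \<in> B" for a b
    using q(2)[of "a * b"] that bounded_span_mono[of e0 e x B] by (auto simp: S_def D_def e_def)
  have Da: "(D * a) * v \<in> bounded_span x B (n + e)" if "a \<in> {y, z}" "v \<in> bounded_span x B n" for a n v
    by (rule bounded_span_mult[OF _ that(2)]) (use Db[OF that(1)] in \<open>simp add: mult.assoc\<close>)
  have Dv: "D * v \<in> bounded_span x B (n + e)" if "v \<in> bounded_span x B n" for n v
    using eval_at_mult_bounded_span[OF that, of q] bounded_span_mono[of "n + degree q" "n + e" x B]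
    by (auto simp: D_def e_def)
  have pow: "a ^ i * v \<in> bounded_span x B (n + i * e)"
    if "\<And>v n. v \<in> bounded_span x B n \<Longrightarrow> a * v \<in> bounded_span x B (n + e)"
       "v \<in> bounded_span x B n" for a i v n
    using that(2)
  proof (induction i)
    case (Suc i)
    then show ?case
      using that(1)[of "a ^ i * v" "n + i * e"] by (simp add: algebra_simps)
  qed simp
  \<comment> \<open>This choice makes \<open>(e + 2 * N * e + 1) * card B \<le> N * (N + 1) < (N + 1)\<^sup>2\<close>.\<close>
  define N where "N = 2 * card B * (e + 1)"
  \<comment> \<open>Each of the at most \<open>2 * N\<close> factors \<open>y\<close>, \<open>z\<close> uses up one \<open>D\<close>; the last \<open>D\<close> brings \<open>1\<close>, which
  need not be in the span of \<open>B\<close>, into the \<open>bounded_span\<close>.\<close>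
  have mem: "D ^ (2 * N + 1) * (y ^ i * z ^ j) \<in> bounded_span x B (e + 2 * N * e)"
    if "i \<le> N" "j \<le> N" for i j
  proof -
    have "(D * y) ^ i * ((D * z) ^ j * (D ^ (2 * N - i - j) * D)) \<in>
        bounded_span x B (((e + (2 * N - i - j) * e) + j * e) + i * e)"
      using D1 Dv Da by (intro pow) auto
    also have "((e + (2 * N - i - j) * e) + j * e) + i * e = e + ((2 * N - i - j) + j + i) * e"
      by (simp add: algebra_simps)
    also have "(2 * N - i - j) + j + i = 2 * N"
      using that by simp
    finally have m: "(D * y) ^ i * ((D * z) ^ j * (D ^ (2 * N - i - j) * D)) \<in>
        bounded_span x B (e + 2 * N * e)" .
    have "2 * N + 1 = i + j + (2 * N - i - j) + 1"
      using that by simp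
    then have "D ^ (2 * N + 1) = D ^ i * D ^ j * D ^ (2 * N - i - j) * D"
      by (metis power_add power_one_right)
    then have "D ^ (2 * N + 1) * (y ^ i * z ^ j) =
        (D * y) ^ i * ((D * z) ^ j * (D ^ (2 * N - i - j) * D))"
      by (simp only: power_mult_distrib mult_ac)
    with m show ?thesis
      by (simp only:)
  qed
  define G where "G = (\<lambda>(k, b). x ^ k * b) ` ({..e + 2 * N * e} \<times> B)"
  have span_G: "bounded_span x B (e + 2 * N * e) = F.span G"
    unfolding bounded_span_def G_def by (rule arg_cong[of _ _ F.span]) auto
  have "card G \<le> (e + 2 * N * e + 1) * card B"
    unfolding G_def using card_image_le[of "{..e + 2 * N * e} \<times> B" "\<lambda>(k, b). x ^ k * b"] B(1) by simp
  also have "\<dots> \<le> (2 * (N + 1) * (e + 1)) * card B"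
    by (intro mult_right_mono) (auto simp: algebra_simps)
  also have "\<dots> = N * (N + 1)"
    by (simp add: N_def algebra_simps)
  also have "\<dots> < (N + 1) * (N + 1)"
    by simp
  also have "\<dots> = card ({..N} \<times> {..N})"
    by simp
  finally have "card G < card ({..N} \<times> {..N})" .
  moreover have "finite G"
    using B by (simp add: G_def)
  ultimately obtain c where c: "\<exists>j\<in>{..N} \<times> {..N}. c j \<noteq> 0"
    "(\<Sum>j\<in>{..N} \<times> {..N}. scaleF emb (c j) (case j of (i, j) \<Rightarrow> D ^ (2 * N + 1) * (y ^ i * z ^ j))) = 0"
    using F.exists_nontrivial_relation[of "{..N} \<times> {..N}" G
        "\<lambda>(i, j). D ^ (2 * N + 1) * (y ^ i * z ^ j)"] mem
    unfolding span_G by fastforce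
  have "0 = D ^ (2 * N + 1) * (\<Sum>i\<le>N. \<Sum>j\<le>N. emb (c (i, j)) * (y ^ i * z ^ j))"
    unfolding c(2)[symmetric] sum.cartesian_product sum_distrib_left
    by (intro sum.cong) (auto simp: scaleF_def algebra_simps)
  then have "0 = (\<Sum>i\<le>N. \<Sum>j\<le>N. emb (c (i, j)) * (y ^ i * z ^ j))"
    using \<open>D \<noteq> 0\<close> by simp
  also have "\<dots> = (\<Sum>j\<le>N. \<Sum>i\<le>N. emb (c (i, j)) * (y ^ i * z ^ j))"
    by (rule sum.swap)
  also have "\<dots> = (\<Sum>j\<le>N. eval_at y (\<Sum>i\<le>N. monom (c (i, j)) i) * z ^ j)"
    by (simp add: eval_at_sum eval_at_monom sum_distrib_right mult.assoc)
  finally have sum0: "(\<Sum>j\<le>N. eval_at y (\<Sum>i\<le>N. monom (c (i, j)) i) * z ^ j) = 0" ..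
  from c(1) obtain i j where ij: "i \<le> N" "j \<le> N" "c (i, j) \<noteq> 0"
    by auto
  have "coeff (\<Sum>i\<le>N. monom (c (i, j)) i) i = c (i, j)"
    using ij by (simp add: coeff_sum coeff_monom)
  with ij have "(\<Sum>i\<le>N. monom (c (i, j)) i) \<noteq> 0"
    by (metis coeff_0)
  with sum0 ij show ?thesis
    by (intro exI[of _ "\<lambda>j. \<Sum>i\<le>N. monom (c (i, j)) i"] exI[of _ N]) auto
qed

end

section \<open>Discreteness of places and their residue field\<close>

locale function_field_place = function_field emb
  for emb :: "'k::alg_closed_field \<Rightarrow> 'f::field" +
  fixes P :: "'f set" and t :: 'f
  assumes place: "P \<in> places emb"
    and local_param: "local_parameter P t"
begin

abbreviation R :: "'f set" where "R \<equiv> ring_of_place P"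

lemma valuation_ring: "valuation_ring_over emb R"
  and in_place_iff_nonunit: "z \<in> P \<longleftrightarrow> z \<in> R \<and> (z = 0 \<or> inverse z \<notin> R)"
proof -
  obtain S where S: "valuation_ring_over emb S" "P = {z \<in> S. z = 0 \<or> inverse z \<notin> S}"
    using place by (auto simp: places_def)
  have "0 \<in> S"
    using S(1) emb_0 by (force simp: valuation_ring_over_def)
  have "z \<in> R \<longleftrightarrow> z \<in> S" for z
  proof (cases "z = 0")
    case False
    then have "z \<in> S \<or> inverse z \<in> S"
      using S(1) by (simp add: valuation_ring_over_def)
    with False show ?thesis
      by (auto simp: ring_of_place_def S(2))
  qed (use \<open>0 \<in> S\<close> in \<open>simp add: ring_of_place_def\<close>)
  then have "R = S"
    by blast
  show "valuation_ring_over emb R"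
    using S(1) unfolding \<open>R = S\<close> .
  show "z \<in> P \<longleftrightarrow> z \<in> R \<and> (z = 0 \<or> inverse z \<notin> R)"
    unfolding \<open>R = S\<close> by (subst S(2)) simp
qed

lemma R_diff: "a \<in> R \<Longrightarrow> b \<in> R \<Longrightarrow> a - b \<in> R"
  and R_mult: "a \<in> R \<Longrightarrow> b \<in> R \<Longrightarrow> a * b \<in> R"
  and R_emb [simp]: "emb c \<in> R"
  and R_total: "z \<in> R \<or> inverse z \<in> R"
proof -
  have ring: "\<forall>a\<in>R. \<forall>b\<in>R. a - b \<in> R \<and> a * b \<in> R" "range emb \<subset> R"
    "\<forall>z. z \<noteq> 0 \<longrightarrow> z \<in> R \<or> inverse z \<in> R"
    using valuation_ring unfolding valuation_ring_over_def by blast+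
  show "a \<in> R \<Longrightarrow> b \<in> R \<Longrightarrow> a - b \<in> R" "a \<in> R \<Longrightarrow> b \<in> R \<Longrightarrow> a * b \<in> R"
    using ring(1) by blast+
  show "emb c \<in> R"
    using ring(2) by blast
  show "z \<in> R \<or> inverse z \<in> R"
    using ring(3) by (cases "z = 0") (auto simp: ring_of_place_def)
qed

lemma R_0 [simp]: "0 \<in> R" and R_1 [simp]: "1 \<in> R"
  using R_emb[of 0] R_emb[of 1] by (simp_all add: emb_one)

lemma R_minus: "a \<in> R \<Longrightarrow> - a \<in> R"
  using R_diff[of 0 a] by simp

lemma R_add: "a \<in> R \<Longrightarrow> b \<in> R \<Longrightarrow> a + b \<in> R"
  using R_diff[of a "- b"] R_minus[of b] by simp

lemma R_power: "a \<in> R \<Longrightarrow> a ^ n \<in> R"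
  by (induction n) (auto intro: R_mult)

lemma R_sum: "(\<And>i. i \<in> S \<Longrightarrow> f i \<in> R) \<Longrightarrow> sum f S \<in> R"
  by (induction S rule: infinite_finite_induct) (auto intro: R_add)

lemma R_eval_at: "y \<in> R \<Longrightarrow> eval_at y p \<in> R"
  by (induction p) (auto intro: R_add R_mult)

lemma in_place_iff_multiple: "z \<in> P \<longleftrightarrow> (\<exists>w\<in>R. z = t * w)"
  using local_param unfolding local_parameter_def by blast

lemma t_in_place: "t \<in> P"
  unfolding in_place_iff_multiple using R_1 by force

lemma t_in_R: "t \<in> R"
  using t_in_place in_place_iff_nonunit by blast

lemma t_nonzero [simp]: "t \<noteq> 0"
proof
  assume "t = 0"
  then have "P = {0}"
    using t_in_place by (auto simp: in_place_iff_multiple)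
  then have "R = UNIV"
    by (auto simp: ring_of_place_def)
  with valuation_ring show False
    by (simp add: valuation_ring_over_def)
qed

lemma in_place_iff: "z \<in> P \<longleftrightarrow> z / t \<in> R"
proof
  assume "z / t \<in> R"
  then have "t * (z / t) \<in> P"
    unfolding in_place_iff_multiple by blast
  then show "z \<in> P"
    by simp
qed (auto simp: in_place_iff_multiple)

lemma place_mult: "a \<in> R \<Longrightarrow> b \<in> P \<Longrightarrow> a * b \<in> P"
  using R_mult[of a "b / t"] by (simp add: in_place_iff)

lemma place_add: "a \<in> P \<Longrightarrow> b \<in> P \<Longrightarrow> a + b \<in> P"
  using R_add[of "a / t" "b / t"] by (simp add: in_place_iff add_divide_distrib)

lemma place_diff: "a \<in> P \<Longrightarrow> b \<in> P \<Longrightarrow> a - b \<in> P"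
  using R_diff[of "a / t" "b / t"] by (simp add: in_place_iff diff_divide_distrib)

lemma place_imp_R: "z \<in> P \<Longrightarrow> z \<in> R"
  using in_place_iff_nonunit by blast

lemma unit_iff: "u \<in> R - P \<longleftrightarrow> u \<noteq> 0 \<and> u \<in> R \<and> inverse u \<in> R"
  using in_place_iff_nonunit[of u] by auto

lemma unit_mult: "u \<in> R - P \<Longrightarrow> w \<in> R - P \<Longrightarrow> u * w \<in> R - P"
  unfolding unit_iff by (simp add: R_mult)

lemma unit_inverse: "u \<in> R - P \<Longrightarrow> inverse u \<in> R - P"
  unfolding unit_iff by auto

lemma unit_powi: "u \<in> R - P \<Longrightarrow> u powi n \<in> R - P"
proof -
  assume u: "u \<in> R - P"
  have "w ^ m \<in> R - P" if "w \<in> R - P" for w m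
  proof (induction m)
    case (Suc m)
    from unit_mult[OF that this] show ?case
      by simp
  qed (use unit_iff[of 1] in simp)
  from this[OF u] this[OF unit_inverse[OF u]] show ?thesis
    by (simp add: power_int_def)
qed

lemma emb_in_place_iff [simp]: "emb c \<in> P \<longleftrightarrow> c = 0"
proof
  assume "emb c \<in> P"
  show "c = 0"
  proof (rule ccontr)
    assume "c \<noteq> 0"
    from inverse_unique[OF emb_inverse[OF this]] have "inverse (emb c) \<in> R"
      by simp
    with \<open>emb c \<in> P\<close> \<open>c \<noteq> 0\<close> show False
      using in_place_iff_nonunit[of "emb c"] by simp
  qed
qed (use in_place_iff_nonunit[of 0] in simp)

lemma one_notin_place [simp]: "1 \<notin> P"
  using emb_in_place_iff[of 1] by (simp add: emb_one)

lemma place_prime: "a \<in> R \<Longrightarrow> b \<in> R \<Longrightarrow> a * b \<in> P \<Longrightarrow> a \<in> P \<or> b \<in> P"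
  using unit_mult[of a b] by blast

text \<open>
  Cancel powers of \<open>z\<close> from an algebraic relation between \<open>y\<close> and \<open>z\<close> until its constant term in
  \<open>z\<close> is given by a nonzero polynomial in \<open>y\<close>; that term is then a multiple of \<open>z\<close>. Taking
  \<open>y = t\<close> shows that the valuation is discrete, and \<open>z = t\<close> that the residue field is algebraic over \<open>K\<close>.
\<close>
lemma exists_eval_in_ideal:
  assumes "y \<in> R" "z \<in> R" "z \<noteq> 0"
  shows "\<exists>p. p \<noteq> 0 \<and> eval_at y p / z \<in> R"
proof -
  obtain p N where "\<exists>j\<le>N. p j \<noteq> 0" "(\<Sum>j\<le>N. eval_at y (p j) * z ^ j) = 0"
    using algebraically_dependent by blast
  then show ?thesis
  proof (induction N arbitrary: p)
    case 0
    then show ?case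
      by (auto intro!: exI[of _ "p 0"])
  next
    case (Suc N)
    define s where "s = (\<Sum>j\<le>N. eval_at y (p (Suc j)) * z ^ j)"
    have "0 = eval_at y (p 0) + z * s"
      using Suc.prems(2) unfolding s_def
      by (subst (asm) sum.atMost_Suc_shift) (simp add: sum_distrib_left algebra_simps)
    then have p0: "eval_at y (p 0) = - (z * s)"
      by (simp add: eq_neg_iff_add_eq_0)
    show ?case
    proof (cases "p 0 = 0")
      case True
      with p0 \<open>z \<noteq> 0\<close> have "s = 0"
        by simp
      moreover have "\<exists>j\<le>N. p (Suc j) \<noteq> 0"
        using Suc.prems(1) True by (metis Suc_le_mono not0_implies_Suc)
      ultimately show ?thesis
        unfolding s_def by (rule Suc.IH[of "\<lambda>j. p (Suc j)", rotated])
    next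
      case False
      have "s \<in> R"
        unfolding s_def using assms by (intro R_sum R_mult R_power R_eval_at)
      then have "eval_at y (p 0) / z \<in> R"
        using p0 \<open>z \<noteq> 0\<close> by (auto intro: R_minus)
      with False show ?thesis
        by blast
    qed
  qed
qed

text \<open>
  The lowest term of a nonzero polynomial in \<open>t\<close> determines its value, since nonzero constants are
  units.
\<close>
lemma eval_at_parameter_nonzero_value:
  assumes "p \<noteq> 0"
  shows "\<exists>n. eval_at t p / t ^ n \<notin> R"
  using assms
proof (induction p)
  case (pCons a p)
  show ?case
  proof (cases "a = 0")
    case True
    with pCons obtain n where "eval_at t p / t ^ n \<notin> R"
      by auto
    with True show ?thesis
      by (intro exI[of _ "Suc n"]) simp
  next
    case False
    have "emb a + t * eval_at t p \<notin> P"
    proof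
      assume "emb a + t * eval_at t p \<in> P"
      moreover have "eval_at t p * t \<in> P"
        by (intro place_mult R_eval_at t_in_R t_in_place)
      ultimately have "emb a \<in> P"
        using place_diff by (metis add_diff_cancel_right' mult.commute)
      with False show False
        by simp
    qed
    then show ?thesis
      by (intro exI[of _ 1]) (simp add: in_place_iff)
  qed
qed simp

text \<open>
  Otherwise the multiples of \<open>z\<close>, among them some nonzero polynomial in \<open>t\<close>, would be divisible by all
  powers of \<open>t\<close>.
\<close>
lemma not_infinitely_divisible:
  assumes "z \<noteq> 0"
  shows "\<exists>n. z / t ^ n \<notin> R"
proof (rule ccontr)
  assume "\<nexists>n. z / t ^ n \<notin> R"
  then have div: "z / t ^ n \<in> R" for n
    by blast
  from div[of 0] have "z \<in> R"
    by simp
  from exists_eval_in_ideal[OF t_in_R this assms] obtain p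
    where p: "p \<noteq> 0" "eval_at t p / z \<in> R"
    by blast
  from eval_at_parameter_nonzero_value[OF p(1)] obtain n where "eval_at t p / t ^ n \<notin> R"
    by blast
  moreover have "eval_at t p / t ^ n = (eval_at t p / z) * (z / t ^ n)"
    using assms by simp
  ultimately show False
    using R_mult[OF p(2) div[of n]] by simp
qed

text \<open>
  Over the algebraically closed field \<open>K\<close> the polynomial \<open>p\<close> splits, and the place is a prime ideal,
  so one of the linear factors \<open>u - c\<close> lies in it.
\<close>
lemma root_mod_place:
  assumes "u \<in> R" "p \<noteq> 0" "eval_at u p \<in> P"
  shows "\<exists>c. u - emb c \<in> P"
  using assms(2,3)
proof (induction "degree p" arbitrary: p rule: less_induct)
  case less
  have "degree p > 0"
  proof (rule ccontr)
    assume "\<not> degree p > 0"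
    then obtain c where "p = [:c:]"
      by (metis degree_eq_zeroE neq0_conv)
    with less.prems show False
      by simp
  qed
  then obtain a where "poly p a = 0"
    using alg_closed_imp_poly_has_root by blast
  then obtain q where q: "p = [:- a, 1:] * q"
    by (metis dvdE poly_eq_0_iff_dvd)
  with less.prems have "q \<noteq> 0"
    by auto
  then have deg: "degree q < degree p"
    unfolding q by (subst degree_mult_eq) auto
  have "eval_at u p = (u - emb a) * eval_at u q"
    unfolding q eval_at_mult by (simp add: emb_one)
  then have "u - emb a \<in> P \<or> eval_at u q \<in> P"
    using less.prems assms(1) by (intro place_prime R_diff R_eval_at R_emb) auto
  with less.hyps[OF deg \<open>q \<noteq> 0\<close>] show ?case
    by blast
qed

lemma residue_exists:
  assumes "u \<in> R"
  shows "\<exists>!c. u - emb c \<in> P"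
proof -
  obtain p where "p \<noteq> 0" "eval_at u p / t \<in> R"
    using exists_eval_in_ideal[OF assms t_in_R t_nonzero] by blast
  then have "\<exists>c. u - emb c \<in> P"
    using root_mod_place[OF assms] in_place_iff by blast
  moreover have "c = d" if "u - emb c \<in> P" "u - emb d \<in> P" for c d
  proof -
    have "emb (d - c) \<in> P"
      using place_diff[OF that] by (simp add: emb_diff)
    then show ?thesis
      by simp
  qed
  ultimately show ?thesis
    by blast
qed

lemma R_t_power_iff: "t powi n \<in> R \<longleftrightarrow> n \<ge> 0"
proof
  assume "t powi n \<in> R"
  show "n \<ge> 0"
  proof (rule ccontr)
    assume "\<not> n \<ge> 0"
    then have "t powi n * t powi (- n - 1) \<in> R"
      using \<open>t powi n \<in> R\<close> by (intro R_mult) (auto simp: power_int_def intro: R_power t_in_R)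
    moreover have "t powi n * t powi (- n - 1) = inverse t"
      by (simp flip: power_int_add)
    ultimately show False
      using t_in_place in_place_iff_nonunit[of t] by simp
  qed
qed (auto simp: power_int_def intro: R_power t_in_R)

lemma unit_t_power_iff: "t powi n \<in> R - P \<longleftrightarrow> n = 0"
  unfolding unit_iff using R_t_power_iff[of n] R_t_power_iff[of "- n"]
  by (auto simp: power_int_minus)

lemma factorization_exists:
  assumes "f \<noteq> 0"
  shows "\<exists>n u. u \<in> R - P \<and> f = t powi n * u"
proof -
  have integral: "\<exists>n u. u \<in> R - P \<and> g = t powi n * u" if g: "g \<in> R" "g \<noteq> 0" for g
  proof -
    define n where "n = (LEAST n. g / t ^ n \<notin> R)"
    have n: "g / t ^ n \<notin> R"
      unfolding n_def using not_infinitely_divisible[OF g(2)] by (rule LeastI_ex)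
    then obtain m where m: "n = Suc m"
      using g by (cases n) auto
    have "g / t ^ m \<in> R"
      using not_less_Least[of m "\<lambda>n. g / t ^ n \<notin> R"] m by (auto simp: n_def)
    moreover have "g / t ^ m \<notin> P"
      using n by (simp add: in_place_iff m mult.commute)
    ultimately show ?thesis
      by (intro exI[of _ "int m"] exI[of _ "g / t ^ m"]) simp
  qed
  show ?thesis
  proof (cases "f \<in> R")
    case False
    then obtain n u where nu: "u \<in> R - P" "inverse f = t powi n * u"
      using integral[of "inverse f"] R_total[of f] assms by auto
    have "f = inverse (t powi n * u)"
      using nu(2) by (metis inverse_inverse_eq)
    then have "f = t powi (- n) * inverse u"
      by (simp add: power_int_minus mult.commute)
    with unit_inverse[OF nu(1)] show ?thesis
      by blast
  qed (use integral assms in blast)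
qed

text \<open>
  The definition of \<open>val\<close> ranges over all local parameters. Two of them differ by a unit \<open>w\<close>, which
  does not change the exponent.
\<close>
lemma val_eqI:
  assumes "u \<in> R - P"
  shows "val P (t powi n * u) = n"
  unfolding val_def
proof (rule the_equality)
  show "\<exists>t' u'. local_parameter P t' \<and> u' \<in> R - P \<and> t powi n * u = t' powi n * u'"
    using local_param assms by blast
next
  fix m assume "\<exists>t' u'. local_parameter P t' \<and> u' \<in> R - P \<and> t powi n * u = t' powi m * u'"
  then obtain t' u' where *: "local_parameter P t'" "u' \<in> R - P" "t powi n * u = t' powi m * u'"
    by blast
  interpret t': function_field_place emb P t'
    by unfold_locales (rule place *)+
  define w where "w = t' / t"
  have "w \<in> R"
    using t'.t_in_place in_place_iff[of t'] by (simp add: w_def)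
  moreover have "inverse w \<in> R"
    using t_in_place t'.in_place_iff[of t] by (simp add: w_def)
  ultimately have w: "w \<in> R - P"
    using unit_iff[of w] by (simp add: w_def)
  have "t' powi m = t powi m * w powi m"
    unfolding power_int_mult_distrib[symmetric] by (simp add: w_def)
  then have eq: "t powi n * u = t powi m * (w powi m * u')"
    using *(3) by (simp add: mult.assoc)
  have "u \<noteq> 0"
    using assms unit_iff[of u] by simp
  then have "t powi (n - m) = (t powi n * u) / (t powi m * u)"
    by (simp add: power_int_diff)
  also have "\<dots> = w powi m * u' * inverse u"
    unfolding eq by (simp add: divide_inverse)
  also have "\<dots> \<in> R - P"
    by (intro unit_mult unit_powi unit_inverse w * assms)
  finally show "m = n"
    using unit_t_power_iff[of "n - m"] by simp
qed

lemma val_ge_iff: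
  assumes "f \<noteq> 0"
  shows "val P f \<ge> N \<longleftrightarrow> f * t powi (- N) \<in> R"
proof -
  obtain n u where nu: "u \<in> R - P" "f = t powi n * u"
    using factorization_exists[OF assms] by blast
  then have u: "u \<noteq> 0" "u \<in> R" "inverse u \<in> R"
    using unit_iff[of u] by simp_all
  have eq: "f * t powi (- N) = t powi (n - N) * u"
    unfolding nu(2) power_int_minus power_int_diff[OF disjI1[OF t_nonzero]] divide_inverse
    by (simp only: mult_ac)
  have "t powi (n - N) * u \<in> R \<longleftrightarrow> t powi (n - N) \<in> R"
  proof
    assume "t powi (n - N) * u \<in> R"
    then have "t powi (n - N) * u * inverse u \<in> R"
      by (rule R_mult[OF _ u(3)])
    then show "t powi (n - N) \<in> R"
      using u(1) by (simp add: mult.assoc)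
  qed (rule R_mult[OF _ u(2)])
  then show ?thesis
    unfolding eq R_t_power_iff using val_eqI[OF nu(1), of n] nu(2) by simp
qed

end

section \<open>Local expansions\<close>

context function_field_place
begin

definition residue :: "'f \<Rightarrow> 'k" where
  "residue u = (THE c. u - emb c \<in> P)"

lemma residue: "u \<in> R \<Longrightarrow> u - emb (residue u) \<in> P"
  unfolding residue_def using theI'[OF residue_exists] .

lemma residue_eqI:
  assumes "u - emb c \<in> P"
  shows "residue u = c"
proof -
  have "u - emb c + emb c \<in> R"
    by (intro R_add place_imp_R assms R_emb)
  then have "u \<in> R"
    by simp
  from the1_equality[OF residue_exists[OF this] assms] show ?thesis
    by (simp add: residue_def)
qed

lemma residue_linear:
  assumes "f \<in> R" "g \<in> R"
  shows "residue (emb c * f + g) = c * residue f + residue g"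
proof (rule residue_eqI)
  have "emb c * (f - emb (residue f)) + (g - emb (residue g)) \<in> P"
    using assms by (intro place_add place_mult residue R_emb)
  then show "emb c * f + g - emb (c * residue f + residue g) \<in> P"
    by (simp add: emb_add emb_mult algebra_simps)
qed

lemma residue_mult:
  assumes "f \<in> R" "g \<in> R"
  shows "residue (f * g) = residue f * residue g"
proof (rule residue_eqI)
  have "g * (f - emb (residue f)) + emb (residue f) * (g - emb (residue g)) \<in> P"
    using assms by (intro place_add place_mult residue R_emb)
  then show "f * g - emb (residue f * residue g) \<in> P"
    by (simp add: emb_mult algebra_simps)
qed

text \<open>
  Dropping the constant term of the expansion at \<open>P\<close> and dividing by \<open>t\<close>; iterating it produces the
  expansion coefficient by coefficient. With \<open>residue\<close> as the evaluation at \<open>P\<close>, the map behaves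
  like a twisted derivation, which makes the product formula for Taylor coefficients a plain
  induction.
\<close>
definition tail :: "'f \<Rightarrow> 'f" where
  "tail f = (f - emb (residue f)) / t"

lemma tail_in_R: "f \<in> R \<Longrightarrow> tail f \<in> R"
  using residue[of f] by (simp add: tail_def in_place_iff)

lemma tail_linear:
  assumes "f \<in> R" "g \<in> R"
  shows "tail (emb c * f + g) = emb c * tail f + tail g"
  unfolding tail_def residue_linear[OF assms] by (simp add: emb_add emb_mult field_simps)

lemma tail_mult:
  assumes "f \<in> R" "g \<in> R"
  shows "tail (f * g) = tail f * g + emb (residue f) * tail g"
  unfolding tail_def residue_mult[OF assms] by (simp add: emb_mult field_simps)

primrec taylor_coeff :: "nat \<Rightarrow> 'f \<Rightarrow> 'k" where
  "taylor_coeff 0 f = residue f"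
| "taylor_coeff (Suc n) f = taylor_coeff n (tail f)"

lemma taylor_coeff_linear:
  assumes "f \<in> R" "g \<in> R"
  shows "taylor_coeff n (emb c * f + g) = c * taylor_coeff n f + taylor_coeff n g"
  using assms
  by (induction n arbitrary: f g) (simp_all add: residue_linear tail_linear tail_in_R)

lemma taylor_coeff_mult:
  assumes "f \<in> R" "g \<in> R"
  shows "taylor_coeff n (f * g) = (\<Sum>i\<le>n. taylor_coeff i f * taylor_coeff (n - i) g)"
  using assms
proof (induction n arbitrary: f g)
  case 0
  then show ?case
    by (simp add: residue_mult)
next
  case (Suc n)
  have "tail (f * g) = emb (residue f) * tail g + tail f * g"
    using Suc.prems by (simp add: tail_mult)
  then have "taylor_coeff (Suc n) (f * g) =
      residue f * taylor_coeff n (tail g) + taylor_coeff n (tail f * g)"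
    using Suc.prems by (simp add: taylor_coeff_linear tail_in_R R_mult)
  also have "taylor_coeff n (tail f * g) =
      (\<Sum>i\<le>n. taylor_coeff i (tail f) * taylor_coeff (n - i) g)"
    using Suc.prems by (intro Suc.IH tail_in_R)
  finally show ?case
    by (subst sum.atMost_Suc_shift) simp
qed

lemma taylor_remainder:
  assumes "f \<in> R"
  shows "(f - (\<Sum>i<n. emb (taylor_coeff i f) * t ^ i)) / t ^ n \<in> R"
  using assms
proof (induction n arbitrary: f)
  case (Suc n)
  have f: "f = emb (residue f) + t * tail f"
    by (simp add: tail_def)
  have "(\<Sum>i<Suc n. emb (taylor_coeff i f) * t ^ i) =
      emb (residue f) + t * (\<Sum>i<n. emb (taylor_coeff i (tail f)) * t ^ i)"
    by (subst sum.lessThan_Suc_shift) (simp add: sum_distrib_left mult.left_commute)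
  then have "f - (\<Sum>i<Suc n. emb (taylor_coeff i f) * t ^ i) =
      t * (tail f - (\<Sum>i<n. emb (taylor_coeff i (tail f)) * t ^ i))"
    by (subst f) (simp add: right_diff_distrib)
  with Suc.IH[OF tail_in_R[OF Suc.prems]] show ?case
    by simp
qed simp

text \<open>
  The partial sums may start at any \<open>k\<close> below which the coefficients vanish. This lets two series be
  compared on a common range, and avoids computing the subdegree of the series of \<open>f\<close>.
\<close>
lemma is_local_expansion_iff:
  assumes "\<And>n. n < k \<Longrightarrow> fls_nth s n = 0"
  shows "is_local_expansion emb P t f s \<longleftrightarrow>
    (\<forall>N. (f - (\<Sum>n\<in>{k..<N}. emb (fls_nth s n) * t powi n)) * t powi (- N) \<in> R)"
proof -
  have "(\<Sum>n\<in>{fls_subdegree s..<N}. emb (fls_nth s n) * t powi n) =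
      (\<Sum>n\<in>{k..<N}. emb (fls_nth s n) * t powi n)" for N
  proof -
    let ?l = "min k (fls_subdegree s)"
    have "(\<Sum>n\<in>{fls_subdegree s..<N}. emb (fls_nth s n) * t powi n) =
        (\<Sum>n\<in>{?l..<N}. emb (fls_nth s n) * t powi n)"
      by (intro sum.mono_neutral_left) auto
    also have "\<dots> = (\<Sum>n\<in>{k..<N}. emb (fls_nth s n) * t powi n)"
      using assms by (intro sum.mono_neutral_right) auto
    finally show ?thesis .
  qed
  moreover have "r = 0 \<or> val P r \<ge> N \<longleftrightarrow> r * t powi (- N) \<in> R" for r N
    using val_ge_iff[of r N] by (cases "r = 0") simp_all
  ultimately show ?thesis
    by (simp add: is_local_expansion_def scaleF_def Let_def)
qed

text \<open>
  The first term in which two expansions differ would be a nonzero constant times \<open>t powi n\<close> that is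
  divisible by \<open>t powi (n + 1)\<close>.
\<close>
lemma local_expansion_unique:
  assumes "is_local_expansion emb P t f s" "is_local_expansion emb P t f s'"
  shows "s = s'"
proof (rule ccontr)
  assume "s \<noteq> s'"
  define d where "d = s - s'"
  define n where "n = fls_subdegree d"
  have "fls_nth d n \<noteq> 0"
    unfolding n_def using \<open>s \<noteq> s'\<close> by (intro nth_fls_subdegree_nonzero) (simp add: d_def)
  define k where "k = min n (min (fls_subdegree s) (fls_subdegree s'))"
  let ?S = "\<lambda>s. \<Sum>i\<in>{k..<n + 1}. emb (fls_nth s i) * t powi i"
  have "(f - ?S s) * t powi (- (n + 1)) \<in> R"
    using is_local_expansion_iff[of k s f] assms(1) by (auto simp: k_def simp del: minus_add_distrib)
  moreover have "(f - ?S s') * t powi (- (n + 1)) \<in> R"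
    using is_local_expansion_iff[of k s' f] assms(2) by (auto simp: k_def simp del: minus_add_distrib)
  ultimately have "(f - ?S s') * t powi (- (n + 1)) - (f - ?S s) * t powi (- (n + 1)) \<in> R"
    by (rule R_diff[rotated])
  also have "(f - ?S s') * t powi (- (n + 1)) - (f - ?S s) * t powi (- (n + 1)) =
      ?S d * t powi (- (n + 1))"
    by (simp add: d_def emb_diff left_diff_distrib sum_subtractf)
  also have "?S d = (\<Sum>i\<in>{n}. emb (fls_nth d i) * t powi i)"
    by (intro sum.mono_neutral_right) (auto simp: k_def n_def)
  also have "\<dots> * t powi (- (n + 1)) = emb (fls_nth d n) * (t powi n * t powi (- (n + 1)))"
    by simp
  also have "t powi n * t powi (- (n + 1)) = inverse t"
    by (simp flip: power_int_add)
  finally have "emb (fls_nth d n) \<in> P"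
    by (simp add: in_place_iff divide_inverse)
  with \<open>fls_nth d n \<noteq> 0\<close> show False
    by simp
qed

text \<open>
  After multiplication by \<open>t powi a\<close> the function is integral at \<open>P\<close>, and its Laurent coefficients
  become Taylor coefficients. For \<open>f \<in> L(A)\<close> and \<open>a = v\<^sub>P(A)\<close> the left-hand side is the coefficient
  that defines \<open>ev\<close>.
\<close>
lemma local_expansion_nth:
  assumes "f * t powi a \<in> R"
  shows "fls_nth (local_expansion emb P t f) (- a + int m) = taylor_coeff m (f * t powi a)"
proof -
  define g where "g = f * t powi a"
  define s where "s = fls_shift a (fps_to_fls (Abs_fps (\<lambda>m. taylor_coeff m g)))"
  have nth: "fls_nth s n = (if n < - a then 0 else taylor_coeff (nat (n + a)) g)" for n
    by (auto simp: s_def)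
  have "is_local_expansion emb P t f s"
  proof (subst is_local_expansion_iff[of "- a"])
    show "\<forall>N. (f - (\<Sum>n\<in>{- a..<N}. emb (fls_nth s n) * t powi n)) * t powi (- N) \<in> R"
    proof
      fix N
      \<comment> \<open>For \<open>N < - a\<close> the sum is empty and \<open>M = 0\<close>; then \<open>int M - a - N\<close> is still nonnegative below.\<close>
      define M where "M = nat (N + a)"
      have shift: "t powi n = t powi (- a) * t ^ nat (n + a)" if "- a \<le> n" for n
      proof -
        have "t powi n = t powi (- a + (n + a))"
          by simp
        also have "\<dots> = t powi (- a) * t powi (n + a)"
          by (rule power_int_add) simp
        also have "t powi (n + a) = t ^ nat (n + a)"
          using that by (simp add: power_int_def)
        finally show ?thesis .
      qed
      have "(\<Sum>n\<in>{- a..<N}. emb (fls_nth s n) * t powi n) =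
          (\<Sum>n\<in>{- a..<N}. t powi (- a) * (emb (taylor_coeff (nat (n + a)) g) * t ^ nat (n + a)))"
      proof (rule sum.cong)
        fix n assume "n \<in> {- a..<N}"
        then have "- a \<le> n"
          by simp
        then have "emb (fls_nth s n) = emb (taylor_coeff (nat (n + a)) g)"
          by (simp add: nth)
        with shift[OF \<open>- a \<le> n\<close>] show "emb (fls_nth s n) * t powi n =
            t powi (- a) * (emb (taylor_coeff (nat (n + a)) g) * t ^ nat (n + a))"
          by (simp only: mult.left_commute)
      qed simp
      also have "\<dots> = (\<Sum>i<M. t powi (- a) * (emb (taylor_coeff i g) * t ^ i))"
        by (rule sum.reindex_bij_witness[of _ "\<lambda>i. int i - a" "\<lambda>n. nat (n + a)"])
          (auto simp: M_def)
      also have "\<dots> = t powi (- a) * (\<Sum>i<M. emb (taylor_coeff i g) * t ^ i)"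
        by (simp add: sum_distrib_left)
      also have "f - \<dots> = t powi (- a) * (g - (\<Sum>i<M. emb (taylor_coeff i g) * t ^ i))"
        by (simp add: g_def right_diff_distrib power_int_minus)
      also have "\<dots> * t powi (- N) =
          ((g - (\<Sum>i<M. emb (taylor_coeff i g) * t ^ i)) / t ^ M) * t powi (int M - a - N)"
      proof -
        have split: "t powi (int M - a - N) = t ^ M * (t powi (- a) * t powi (- N))"
          unfolding power_int_diff[OF disjI1[OF t_nonzero]] power_int_minus power_int_of_nat divide_inverse
          by (simp only: mult.assoc)
        have cancel: "u * r * v = r / c * (c * (u * v))" if "c \<noteq> 0" for c r u v :: 'f
          using that by simp
        show ?thesis
          unfolding split by (rule cancel) simp
      qed
      also have "\<dots> \<in> R"
        using assms by (intro R_mult taylor_remainder) (auto simp: g_def R_t_power_iff M_def)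
      finally show "(f - (\<Sum>n\<in>{- a..<N}. emb (fls_nth s n) * t powi n)) * t powi (- N) \<in> R" .
    qed
  qed (simp add: nth)
  then have "local_expansion emb P t f = s"
    unfolding local_expansion_def using local_expansion_unique by blast
  then show ?thesis
    by (simp add: nth g_def)
qed

end

section \<open>The bilinear form of a formal expression\<close>

text \<open>
  The symbols \<open>ev(P, i)\<close> with \<open>i \<le> r\<^sub>P(X)\<close>, that is the symbols counted by the divisor of \<open>X\<close>.
\<close>
definition expr_indices :: "('p set \<times> nat \<Rightarrow>\<^sub>0 'k::zero) \<Rightarrow> ('p set \<times> nat) set" where
  "expr_indices X = {(P, i). \<exists>m\<ge>i. Poly_Mapping.lookup X (P, m) \<noteq> 0}"

text \<open>
  The bilinear form \<open>(f, g) \<mapsto> X(f g)\<close>, written in the coordinates \<open>x = (ev(P, i)(f))\<close> and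
  \<open>y = (ev(P, i)(g))\<close>.
\<close>
definition expr_form :: "('p set \<times> nat \<Rightarrow>\<^sub>0 'k::field) \<Rightarrow> ('p set \<times> nat \<Rightarrow> 'k) \<Rightarrow> ('p set \<times> nat \<Rightarrow> 'k) \<Rightarrow> 'k" where
  "expr_form X x y = (\<Sum>(P, m)\<in>Poly_Mapping.keys X.
     Poly_Mapping.lookup X (P, m) * (\<Sum>i\<le>m. x (P, i) * y (P, m - i)))"

lemma expr_form_add_left: "expr_form X (x + y) z = expr_form X x z + expr_form X y z"
  and expr_form_add_right: "expr_form X z (x + y) = expr_form X z x + expr_form X z y"
  and expr_form_scale_left: "expr_form X (scale_form c x) z = c * expr_form X x z"
  and expr_form_scale_right: "expr_form X z (scale_form c x) = c * expr_form X z x"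
  by (simp_all add: expr_form_def sum.distrib sum_distrib_left scale_form_def case_prod_unfold
      algebra_simps)

lemma finite_exponents: "finite {m. Poly_Mapping.lookup X (P, m) \<noteq> 0}"
proof -
  have "finite (snd ` Poly_Mapping.keys X)"
    by simp
  then show ?thesis
    by (rule finite_subset[rotated]) (force simp: in_keys_iff)
qed

lemma expr_indices_iff: "(P, i) \<in> expr_indices X \<longleftrightarrow> int i \<le> top_index X P"
proof (cases "\<forall>m. Poly_Mapping.lookup X (P, m) = 0")
  case False
  then have "{m. Poly_Mapping.lookup X (P, m) \<noteq> 0} \<noteq> {}"
    by auto
  with False show ?thesis
    by (auto simp: expr_indices_def top_index_def Max_ge_iff[OF finite_exponents])
qed (simp add: expr_indices_def top_index_def)

lemma expr_indices_eq_Sigma: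
  "expr_indices X = Sigma (fst ` Poly_Mapping.keys X) (\<lambda>P. {..<nat (top_index X P + 1)})"
proof -
  have "P \<in> fst ` Poly_Mapping.keys X" if "(P, i) \<in> expr_indices X" for P i
    using that by (force simp: expr_indices_def in_keys_iff)
  then show ?thesis
    by (auto simp: expr_indices_iff)
qed

lemma finite_expr_indices: "finite (expr_indices X)"
  by (simp add: expr_indices_eq_Sigma)

lemma top_index_plus_1_nonneg: "0 \<le> top_index X P + 1"
  by (simp add: top_index_def)

lemma lookup_expr_divisor: "Poly_Mapping.lookup (expr_divisor X) P = top_index X P + 1"
proof -
  have "Poly_Mapping.lookup (expr_divisor X) P =
      (\<Sum>Q\<in>fst ` Poly_Mapping.keys X. if Q = P then top_index X P + 1 else 0)"
    unfolding expr_divisor_def lookup_sum by (intro sum.cong) (auto simp: lookup_single when_def)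
  also have "\<dots> = top_index X P + 1"
  proof (cases "P \<in> fst ` Poly_Mapping.keys X")
    case False
    then have "Poly_Mapping.lookup X (P, m) = 0" for m
      by (force simp: in_keys_iff)
    with False show ?thesis
      by (simp add: top_index_def)
  qed simp
  finally show ?thesis .
qed

lemma weight_eq_card: "weight X = int (card (expr_indices X))"
proof -
  have "P \<in> fst ` Poly_Mapping.keys X" if "top_index X P + 1 \<noteq> 0" for P
    using that by (force simp: top_index_def in_keys_iff split: if_splits)
  then have "Poly_Mapping.keys (expr_divisor X) \<subseteq> fst ` Poly_Mapping.keys X"
    by (auto simp: in_keys_iff lookup_expr_divisor simp del: image_iff)
  then have "weight X = (\<Sum>P\<in>fst ` Poly_Mapping.keys X. top_index X P + 1)"
    unfolding weight_def deg_def lookup_expr_divisor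
    by (intro sum.mono_neutral_left) (auto simp: in_keys_iff lookup_expr_divisor)
  also have "\<dots> = (\<Sum>P\<in>fst ` Poly_Mapping.keys X. int (nat (top_index X P + 1)))"
    by (simp add: top_index_plus_1_nonneg)
  also have "\<dots> = int (card (expr_indices X))"
    unfolding expr_indices_eq_Sigma by (subst card_SigmaI) (simp_all del: int_nat_eq)
  finally show ?thesis .
qed

text \<open>
  At a place \<open>P\<close> the matrix of the form is the Hankel matrix \<open>\<lambda>\<close> with entries \<open>\<lambda>(P, i + j)\<close>, where
  \<open>i, j \<le> r = r\<^sub>P(X)\<close>. It vanishes for \<open>i + j > r\<close> and has the nonzero entry \<open>\<lambda>(P, r)\<close> throughout
  the antidiagonal, so pairing \<open>y\<close> with the basis vector of index \<open>r - j\<close> determines \<open>y (P, j)\<close> from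
  the coordinates of smaller index.
\<close>
lemma expr_form_nondegenerate:
  assumes y: "\<And>i. i \<notin> expr_indices X \<Longrightarrow> y i = 0"
    and perp: "\<And>i. i \<in> expr_indices X \<Longrightarrow> expr_form X (unit_vector i) y = 0"
  shows "y = 0"
proof -
  have "y (P, j) = 0" for P j
  proof (induction j rule: less_induct)
    case (less j)
    show ?case
    proof (cases "(P, j) \<in> expr_indices X")
      case True
      define r where "r = nat (top_index X P)"
      have r: "top_index X P = int r" "j \<le> r"
        using True by (auto simp: expr_indices_iff r_def)
      then have "r = Max {m. Poly_Mapping.lookup X (P, m) \<noteq> 0}"
        "\<not> (\<forall>m. Poly_Mapping.lookup X (P, m) = 0)"
        by (auto simp: top_index_def split: if_splits)
      then have lead: "Poly_Mapping.lookup X (P, r) \<noteq> 0"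
        using Max_in[OF finite_exponents[of X P]] by auto
      have le: "m \<le> r" if "Poly_Mapping.lookup X (P, m) \<noteq> 0" for m
        using that r(1) expr_indices_iff[of P m X] by (auto simp: expr_indices_def)
      have inner: "(\<Sum>i\<le>m. unit_vector (P, r - j) (Q, i) * y (Q, m - i)) =
          (if Q = P \<and> r - j \<le> m then y (P, m - (r - j)) else 0)" for Q m
        by (cases "Q = P")
          (simp_all add: unit_vector_def if_distrib[where f = "\<lambda>x. x * _"] cong: if_cong)
      have "0 = expr_form X (unit_vector (P, r - j)) y"
        using r by (intro perp[symmetric]) (simp add: expr_indices_iff)
      also have "\<dots> = (\<Sum>(Q, m)\<in>Poly_Mapping.keys X. Poly_Mapping.lookup X (Q, m) *
          (if Q = P \<and> r - j \<le> m then y (P, m - (r - j)) else 0))"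
        unfolding expr_form_def inner ..
      also have "\<dots> = (\<Sum>(Q, m)\<in>{(P, r)}. Poly_Mapping.lookup X (Q, m) *
          (if Q = P \<and> r - j \<le> m then y (P, m - (r - j)) else 0))"
      proof (intro sum.mono_neutral_right)
        show "{(P, r)} \<subseteq> Poly_Mapping.keys X"
          using lead by (simp add: in_keys_iff)
        have vanish: "y (P, m - (r - j)) = 0"
          if "Poly_Mapping.lookup X (P, m) \<noteq> 0" "m \<noteq> r" "r - j \<le> m" for m
          using le[OF that(1)] that r(2) by (intro less.IH) linarith
        show "\<forall>i\<in>Poly_Mapping.keys X - {(P, r)}. (case i of (Q, m) \<Rightarrow>
            Poly_Mapping.lookup X (Q, m) *
            (if Q = P \<and> r - j \<le> m then y (P, m - (r - j)) else 0)) = 0"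
        proof
          fix i assume i: "i \<in> Poly_Mapping.keys X - {(P, r)}"
          obtain Q m where Qm: "i = (Q, m)"
            by (cases i)
          show "(case i of (Q, m) \<Rightarrow> Poly_Mapping.lookup X (Q, m) *
              (if Q = P \<and> r - j \<le> m then y (P, m - (r - j)) else 0)) = 0"
          proof (cases "Q = P \<and> r - j \<le> m")
            case True
            then have "y (P, m - (r - j)) = 0"
              using i by (intro vanish) (auto simp: Qm in_keys_iff)
            then show ?thesis
              by (simp add: Qm)
          qed (auto simp: Qm)
        qed
      qed simp
      also have "\<dots> = Poly_Mapping.lookup X (P, r) * y (P, j)"
        using r by simp
      finally show ?thesis
        using lead by simp
    qed (simp add: y)
  qed
  then show ?thesis
    by (auto simp: fun_eq_iff)
qed

text \<open>
  Both factors of every term have an index \<open>\<le> m\<close> for some \<open>(P, m)\<close> in \<open>X\<close>, so only the coordinates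
  in \<open>expr_indices X\<close> matter.
\<close>
lemma expr_form_cong:
  assumes "\<And>i. i \<in> expr_indices X \<Longrightarrow> x i = x' i" "\<And>i. i \<in> expr_indices X \<Longrightarrow> y i = y' i"
  shows "expr_form X x y = expr_form X x' y'"
proof -
  have "(P, i) \<in> expr_indices X" if "(P, m) \<in> Poly_Mapping.keys X" "i \<le> m" for P m i
    using that by (auto simp: expr_indices_def in_keys_iff)
  then show ?thesis
    unfolding expr_form_def using assms by (auto intro!: sum.cong)
qed

section \<open>Evaluation forms on Riemann-Roch spaces\<close>

locale function_field_parameters = function_field emb
  for emb :: "'k::alg_closed_field \<Rightarrow> 'f::field" +
  fixes t :: "'f set \<Rightarrow> 'f"
  assumes local_parameter_t: "P \<in> places emb \<Longrightarrow> local_parameter P (t P)"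
begin

lemma at_place: "P \<in> places emb \<Longrightarrow> function_field_place emb P (t P)"
  by unfold_locales (auto intro: local_parameter_t)

text \<open>
  Describing \<open>L(A)\<close> by membership in valuation rings covers the function \<open>0\<close> uniformly.
\<close>
lemma in_RR_space_iff:
  "f \<in> RR_space emb A \<longleftrightarrow>
     (\<forall>P\<in>places emb. f * t P powi Poly_Mapping.lookup A P \<in> ring_of_place P)"
proof (cases "f = 0")
  case True
  then show ?thesis
    by (simp add: RR_space_def ring_of_place_def)
next
  case False
  have "val P f + Poly_Mapping.lookup A P \<ge> 0 \<longleftrightarrow>
      f * t P powi Poly_Mapping.lookup A P \<in> ring_of_place P" if "P \<in> places emb" for P
    using function_field_place.val_ge_iff[OF at_place[OF that] False, of "- Poly_Mapping.lookup A P"]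
    by (auto simp: add.commute)
  with False show ?thesis
    by (simp add: RR_space_def)
qed

lemma RR_space_linear:
  assumes "f \<in> RR_space emb A" "g \<in> RR_space emb A"
  shows "scaleF emb c f + g \<in> RR_space emb A"
  unfolding in_RR_space_iff
proof
  fix P assume P: "P \<in> places emb"
  interpret function_field_place emb P "t P"
    by (rule at_place[OF P])
  have "emb c * (f * t P powi Poly_Mapping.lookup A P) + g * t P powi Poly_Mapping.lookup A P \<in> R"
    using assms P unfolding in_RR_space_iff by (blast intro: R_add R_mult R_emb)
  then show "(scaleF emb c f + g) * t P powi Poly_Mapping.lookup A P \<in> R"
    by (simp add: scaleF_def distrib_right mult.assoc)
qed

lemma RR_space_mult:
  assumes "f \<in> RR_space emb A" "g \<in> RR_space emb B"
  shows "f * g \<in> RR_space emb (A + B)"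
  unfolding in_RR_space_iff
proof
  fix P assume P: "P \<in> places emb"
  interpret function_field_place emb P "t P"
    by (rule at_place[OF P])
  have "(f * t P powi Poly_Mapping.lookup A P) * (g * t P powi Poly_Mapping.lookup B P) \<in> R"
    using assms P unfolding in_RR_space_iff by (blast intro: R_mult)
  then show "(f * g) * t P powi Poly_Mapping.lookup (A + B) P \<in> R"
    by (simp add: lookup_add power_int_add mult_ac)
qed

lemma ev_eq_taylor_coeff:
  assumes "P \<in> places emb" "f \<in> RR_space emb A"
  shows "ev emb t A P m f =
    function_field_place.taylor_coeff emb P (t P) m (f * t P powi Poly_Mapping.lookup A P)"
  using assms function_field_place.local_expansion_nth[OF at_place[OF assms(1)]]
  by (simp add: ev_def in_RR_space_iff)

lemma ev_linear:
  assumes "P \<in> places emb" "f \<in> RR_space emb A" "g \<in> RR_space emb A"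
  shows "ev emb t A P m (scaleF emb c f + g) = c * ev emb t A P m f + ev emb t A P m g"
proof -
  interpret function_field_place emb P "t P"
    by (rule at_place[OF assms(1)])
  let ?f = "f * t P powi Poly_Mapping.lookup A P" and ?g = "g * t P powi Poly_Mapping.lookup A P"
  have "?f \<in> R" "?g \<in> R"
    using assms by (auto simp: in_RR_space_iff)
  moreover have "(scaleF emb c f + g) * t P powi Poly_Mapping.lookup A P = emb c * ?f + ?g"
    by (simp add: scaleF_def distrib_right mult.assoc)
  ultimately show ?thesis
    using assms by (simp add: ev_eq_taylor_coeff RR_space_linear taylor_coeff_linear)
qed

lemma ev_sum:
  assumes "P \<in> places emb" "\<And>i. i \<in> I \<Longrightarrow> f i \<in> RR_space emb A"
  shows "ev emb t A P m (\<Sum>i\<in>I. scaleF emb (c i) (f i)) = (\<Sum>i\<in>I. c i * ev emb t A P m (f i))"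
proof -
  have zero: "0 \<in> RR_space emb A"
    by (simp add: RR_space_def)
  have "ev emb t A P m 0 = 0"
    using ev_linear[OF assms(1) zero zero, of m "- 1"] by (simp add: scaleF_def)
  then have "(\<Sum>i\<in>I. scaleF emb (c i) (f i)) \<in> RR_space emb A \<and>
      ev emb t A P m (\<Sum>i\<in>I. scaleF emb (c i) (f i)) = (\<Sum>i\<in>I. c i * ev emb t A P m (f i))"
    using assms zero
    by (induction I rule: infinite_finite_induct) (auto simp: RR_space_linear ev_linear)
  then show ?thesis ..
qed

text \<open>
  Coefficient \<open>m\<close> of the product of two local expansions that start at \<open>- v\<^sub>P(A)\<close> and \<open>- v\<^sub>P(B)\<close>.
\<close>
lemma ev_mult:
  assumes "P \<in> places emb" "f \<in> RR_space emb A" "g \<in> RR_space emb B"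
  shows "ev emb t (A + B) P m (f * g) = (\<Sum>i\<le>m. ev emb t A P i f * ev emb t B P (m - i) g)"
proof -
  interpret function_field_place emb P "t P"
    by (rule at_place[OF assms(1)])
  let ?f = "f * t P powi Poly_Mapping.lookup A P" and ?g = "g * t P powi Poly_Mapping.lookup B P"
  have "?f \<in> R" "?g \<in> R"
    using assms by (auto simp: in_RR_space_iff)
  have "f * g * t P powi Poly_Mapping.lookup (A + B) P = ?f * ?g"
    by (simp add: lookup_add power_int_add mult_ac)
  then have "ev emb t (A + B) P m (f * g) = taylor_coeff m (?f * ?g)"
    using ev_eq_taylor_coeff[OF assms(1) RR_space_mult[OF assms(2,3)]] by (simp only:)
  also have "\<dots> = (\<Sum>i\<le>m. taylor_coeff i ?f * taylor_coeff (m - i) ?g)"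
    by (rule taylor_coeff_mult) fact+
  finally show ?thesis
    using assms by (simp add: ev_eq_taylor_coeff)
qed

lemma projection_mult:
  assumes "X \<in> formal_expressions emb" "f \<in> RR_space emb A" "g \<in> RR_space emb B"
  shows "projection emb t (A + B) X (f * g) =
    expr_form X (\<lambda>(P, i). ev emb t A P i f) (\<lambda>(P, i). ev emb t B P i g)"
proof -
  have "P \<in> places emb" if "(P, m) \<in> Poly_Mapping.keys X" for P m
    using assms(1) that by (auto simp: formal_expressions_def)
  then show ?thesis
    using assms(2,3)
    by (auto simp: projection_def expr_form_def sum_fun_apply scale_form_def ev_mult intro!: sum.cong)
qed

end

section \<open>Isotropy and the codimension bound\<close>

theorem proposition3p8:
  fixes emb :: "'k::alg_closed_field \<Rightarrow> 'f::field"
    and t :: "'f set \<Rightarrow> 'f"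
    and A :: "'f set \<Rightarrow>\<^sub>0 int"
    and U T :: "'f set"
    and \<phi> :: "'f \<Rightarrow> 'k"
    and X :: "'f set \<times> nat \<Rightarrow>\<^sub>0 'k"
    and w :: int
  assumes "function_field emb"
    and "\<And>P. P \<in> places emb \<Longrightarrow> local_parameter P (t P)"
    and "A \<in> divisors emb"
    and "deg A \<ge> 2 * genus emb - 1"
    and "module.subspace (scaleF emb) U"
    and "U \<subseteq> RR_space emb A"
    and "\<phi> \<in> annihilator emb (A + A) (square_space emb U)"
    and "X \<in> formal_expressions emb"
    and "weight X = w"
    and "\<phi> = projection emb t (A + A) X"
    and "T = U \<inter> (\<Inter>\<chi>\<in>ev_span emb t (expr_divisor X) A. {f \<in> RR_space emb A. \<chi> f = 0})"
  shows "ereal_of_enat (codim emb U T) \<le> ereal (real_of_int w / 2)"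
proof -
  interpret function_field_parameters emb t
    using assms(1,2) by (intro function_field_parameters.intro function_field_parameters_axioms.intro)
  let ?I = "expr_indices X"
  \<comment> \<open>The coordinate map \<open>U \<rightarrow> K\<^sup>w\<close>, as functions supported on the \<open>w\<close> indices of \<open>X\<close>.\<close>
  define e where "e f = (\<lambda>(P, i). if (P, i) \<in> ?I then ev emb t A P i f else 0)" for f
  have index_place: "P \<in> places emb" if "(P, i) \<in> ?I" for P i
    using that \<open>X \<in> formal_expressions emb\<close>
    by (auto simp: formal_expressions_def expr_indices_def simp flip: in_keys_iff)
  have isotropic: "expr_form X (e f) (e g) = 0" if "f \<in> U" "g \<in> U" for f g
  proof -
    have "f * g \<in> square_space emb U"
      unfolding square_space_def using that by (intro F.span_base) blast
    then have "projection emb t (A + A) X (f * g) = 0"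
      using assms(7,10) by (auto simp: annihilator_def)
    moreover have "f \<in> RR_space emb A" "g \<in> RR_space emb A"
      using that assms(6) by auto
    ultimately have "expr_form X (\<lambda>(P, i). ev emb t A P i f) (\<lambda>(P, i). ev emb t A P i g) = 0"
      using projection_mult[OF assms(8)] by simp
    then show ?thesis
      by (subst expr_form_cong[where x' = "\<lambda>(P, i). ev emb t A P i f"
            and y' = "\<lambda>(P, i). ev emb t A P i g"]) (auto simp: e_def)
  qed
  have kernel: "f \<in> T" if f: "f \<in> U" "e f = 0" for f
  proof -
    have "\<chi> f = 0" if "\<chi> \<in> ev_span emb t (expr_divisor X) A" for \<chi>
      using that unfolding ev_span_def
    proof (induction rule: form.span_induct_alt)
      case (step c x y)
      then obtain P m where "x = ev emb t A P m" "(P, m) \<in> ?I"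
        by (auto simp: lookup_expr_divisor expr_indices_iff)
      with fun_cong[OF f(2), of "(P, m)"] have "x f = 0"
        by (simp add: e_def)
      with step show ?case
        by (simp add: scale_form_def)
    qed simp
    with f(1) show ?thesis
      using assms(6,11) by auto
  qed
  \<comment> \<open>A set that is independent modulo \<open>T\<close> stays independent under \<open>e\<close>, and its image is isotropic.\<close>
  have bound: "2 * card B \<le> card ?I"
    if B: "finite B" "B \<subseteq> U"
      and indep: "\<And>c. (\<Sum>b\<in>B. scaleF emb (c b) b) \<in> T \<Longrightarrow> \<forall>b\<in>B. c b = 0" for B
  proof -
    have "inj_on e B \<and> form.independent (e ` B)"
    proof (rule form.family_independent[OF B(1)])
      fix c assume c: "(\<Sum>b\<in>B. scale_form (c b) (e b)) = 0"
      have "e (\<Sum>b\<in>B. scaleF emb (c b) b) = (\<Sum>b\<in>B. scale_form (c b) (e b))"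
      proof
        fix i :: "'f set \<times> nat"
        obtain P m where i: "i = (P, m)"
          by (cases i)
        have "ev emb t A P m (\<Sum>b\<in>B. scaleF emb (c b) b) = (\<Sum>b\<in>B. c b * ev emb t A P m b)"
          if "(P, m) \<in> ?I"
          using B(2) assms(6) that index_place by (intro ev_sum) auto
        then show "e (\<Sum>b\<in>B. scaleF emb (c b) b) i = (\<Sum>b\<in>B. scale_form (c b) (e b)) i"
          by (simp add: i e_def sum_fun_apply scale_form_def)
      qed
      moreover have "(\<Sum>b\<in>B. scaleF emb (c b) b) \<in> U"
        using B(2) by (intro F.subspace_sum F.subspace_scale assms(5)) auto
      ultimately show "\<forall>b\<in>B. c b = 0"
        using c by (intro indep kernel) auto
    qed
    moreover have "2 * card (e ` B) \<le> card (unit_vector ` ?I :: ('f set \<times> nat \<Rightarrow> 'k) set)"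
    proof (rule form.isotropic_dim_le_half)
      show "form.independent (e ` B)"
        using calculation by blast
      show "e ` B \<subseteq> form.span (unit_vector ` ?I)"
        by (auto simp: in_span_unit_vectors_iff finite_expr_indices e_def)
      show "y = 0" if "y \<in> form.span (unit_vector ` ?I)"
        "\<And>x. x \<in> unit_vector ` ?I \<Longrightarrow> expr_form X x y = 0" for y
        using that by (intro expr_form_nondegenerate[of X])
          (auto simp: in_span_unit_vectors_iff finite_expr_indices)
      show "expr_form X x y = 0" if "x \<in> e ` B" "y \<in> e ` B" for x y
        using that B(2) isotropic by auto
    qed (simp_all add: finite_expr_indices expr_form_add_left expr_form_add_right
        expr_form_scale_left expr_form_scale_right)
    ultimately show ?thesis
      by (simp add: card_image inj_on_subset[OF inj_unit_vector])
  qed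
  have "codim emb U T \<le> enat (card ?I div 2)"
    unfolding codim_def using bound by (intro SUP_least) fastforce
  then have "ereal_of_enat (codim emb U T) \<le> ereal (real (card ?I div 2))"
    using ereal_of_enat_le_iff by (metis ereal_of_enat_simps(1))
  also have "\<dots> \<le> ereal (real_of_int w / 2)"
  proof -
    have "real (2 * (card ?I div 2)) \<le> real (card ?I)"
      by (rule of_nat_mono) simp
    then show ?thesis
      using assms(9) weight_eq_card[of X] by simp
  qed
  finally show ?thesis .
qed

end
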